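(* For every $n\geq 0$ and $a,b\geq 0$, the number of partitions of $n$ having pairing index $a$ and pairing width $b$ equals the number of partitions of $n$ having exactly $a$ parts and largest part $b$.
   Context: For an integer partition $\lambda$, pair equal parts of $\lambda$ as far as possible: for each part size occurring with odd multiplicity exactly one copy remains unpaired, and a part size of even multiplicity is completely paired. Let $r(\lambda)$ be the largest part size that participates in at least one pair (i.e. of multiplicity at least $2$), with $r(\lambda)=0$ if $\lambda$ has distinct parts. Write the unpaired parts (the part sizes of odd multiplicity, each once) in decreasing order $u_1>u_2>\cdots>u_j$ and let $s(\lambda)=u_1-u_2+u_3-u_4+\cdots$ (so $s(\lambda)=0$ if there are no unpaired parts). The pairing index of $\lambda$ is $T(\lambda)=r(\lambda)+s(\lambda)$. The pair span of $\lambda$ is the number of parts of $\lambda$ (counted with multiplicity) that belong to pairs. The residual span of $\lambda$ is $2\bigl(u_1-s(\lambda)\bigr)+1$ if there is at least one unpaired part, and $0$ if there are no unpaired parts. The pairing width $W(\lambda)$ is the larger of the pair span and the residual span. The empty partition has $0$ parts and largest part $0$. *)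

theory Defs
  imports Main "HOL-Library.Multiset"
begin

text \<open>An integer partition is the multiset of its parts, all of which are positive.\<close>

definition partitions_of :: "nat \<Rightarrow> nat multiset set" where
  "partitions_of n = {L. 0 \<notin># L \<and> sum_mset L = n}"

definition largest_part :: "nat multiset \<Rightarrow> nat" where
  "largest_part L = Max (insert 0 (set_mset L))"

definition unpaired_parts :: "nat multiset \<Rightarrow> nat set" where
  "unpaired_parts L = {k \<in> set_mset L. odd (count L k)}"

definition paired_parts :: "nat multiset \<Rightarrow> nat multiset" where
  "paired_parts L = L - mset_set (unpaired_parts L)"

lemma count_paired_parts: "count (paired_parts L) k = 2 * (count L k div 2)"
proof -
  have "finite (unpaired_parts L)"
    by (simp add: unpaired_parts_def)
  then show ?thesis
    by (cases "k \<in> unpaired_parts L")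
      (auto simp: paired_parts_def unpaired_parts_def count_mset_set' not_in_iff)
qed

lemma in_paired_parts_iff: "k \<in># paired_parts L \<longleftrightarrow> count L k \<ge> 2"
  by (simp add: count_paired_parts div_greater_zero_iff flip: count_greater_zero_iff)

text \<open>\<open>alt_sum [u1, u2, u3, \<dots>] = u1 - u2 + u3 - \<dots>\<close>, taken over the
  integers because subtraction on the naturals truncates.\<close>

fun alt_sum :: "nat list \<Rightarrow> int" where
  "alt_sum [] = 0"
| "alt_sum (u # us) = int u - alt_sum us"

definition pair_rank :: "nat multiset \<Rightarrow> nat" where
  "pair_rank L = Max (insert 0 (set_mset (paired_parts L)))"

definition unpaired_alt_sum :: "nat multiset \<Rightarrow> int" where
  "unpaired_alt_sum L = alt_sum (rev (sorted_list_of_set (unpaired_parts L)))"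

definition pairing_index :: "nat multiset \<Rightarrow> int" where
  "pairing_index L = int (pair_rank L) + unpaired_alt_sum L"

definition pair_span :: "nat multiset \<Rightarrow> nat" where
  "pair_span L = size (paired_parts L)"

definition residual_span :: "nat multiset \<Rightarrow> int" where
  "residual_span L =
    (if unpaired_parts L = {} then 0
     else 2 * (int (Max (unpaired_parts L)) - unpaired_alt_sum L) + 1)"

definition pairing_width :: "nat multiset \<Rightarrow> int" where
  "pairing_width L = max (int (pair_span L)) (residual_span L)"

end

theory Submission
  imports Defs
begin

text \<open>Write a partition as \<open>\<mu> \<union> \<mu> \<union> \<delta>\<close> with \<open>\<delta>\<close> having distinct parts. The conjugate of
  \<open>\<mu> \<union> \<mu>\<close> is a partition into even parts whose number of parts is the pair rank and whose
  largest part is the pair span. Sylvester's fish-hook bijection sends \<open>\<delta>\<close> to a partition into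
  odd parts whose number of parts is the alternating sum of \<open>\<delta>\<close> and whose largest part is the
  residual span. The union of these two partitions has as many parts as the pairing index, and
  the pairing width as its largest part; its even and odd parts recover both pieces.\<close>

section \<open>Largest parts and shifts of multisets\<close>

lemma largest_part_empty [simp]: "largest_part {#} = 0"
  by (simp add: largest_part_def)

lemma largest_part_add_mset [simp]: "largest_part (add_mset x M) = max x (largest_part M)"
  by (simp add: largest_part_def insert_commute[of 0 x])

lemma largest_part_union [simp]: "largest_part (M + N) = max (largest_part M) (largest_part N)"
  by (induction M) auto

lemma largest_part_replicate [simp]: "largest_part (replicate_mset n x) = (if n = 0 then 0 else x)"
  by (induction n) auto

lemma largest_part_image_add [simp]:
  "largest_part (image_mset (\<lambda>x. x + c) M) = (if M = {#} then 0 else largest_part M + c)"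
  by (induction M) auto

lemma le_largest_part: "x \<in># M \<Longrightarrow> x \<le> largest_part M"
  by (simp add: largest_part_def)

lemma largest_part_in: "M \<noteq> {#} \<Longrightarrow> largest_part M \<in># M"
proof (induction M)
  case (add x M)
  then show ?case by (cases "M = {#}") (auto simp: max_def)
qed simp

lemma largest_part_mono: "M \<subseteq># N \<Longrightarrow> largest_part M \<le> largest_part N"
  by (auto simp: subset_mset.le_iff_add)

lemma sum_mset_image_add:
  "sum_mset (image_mset (\<lambda>x. x + c) M) = sum_mset M + c * size M" for c :: nat
  by (induction M) auto

lemma image_mset_add_inj:
  "image_mset (\<lambda>x. x + c) M = image_mset (\<lambda>x. x + c) N \<Longrightarrow> M = N" for c :: nat
  using multiset.inj_map[of "\<lambda>x. x + c"] by (simp add: inj_def)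

section \<open>Conjugating a partition with every part doubled\<close>

text \<open>For a decreasing list, these are the column lengths of the diagram having each entry as
  a row twice. Two more rows of length \<open>x\<close> on top lengthen every old column by 2 and
  open new columns of height 2.\<close>

fun even_conj :: "nat list \<Rightarrow> nat multiset" where
  "even_conj [] = {#}"
| "even_conj (x # xs) =
    image_mset (\<lambda>y. y + 2) (even_conj xs) + replicate_mset (x - size (even_conj xs)) 2"

lemma size_even_conj:
  "sorted_wrt (\<ge>) xs \<Longrightarrow> size (even_conj xs) = (if xs = [] then 0 else hd xs)"
  by (induction xs) (auto simp: neq_Nil_conv)

lemma sum_mset_even_conj:
  "sorted_wrt (\<ge>) xs \<Longrightarrow> sum_mset (even_conj xs) = 2 * sum_list xs"
proof (induction xs)
  case (Cons x xs)
  then have "size (even_conj xs) \<le> x"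
    using size_even_conj[of xs] by (cases xs) auto
  with Cons show ?case
    by (simp add: sum_mset_image_add del: add_2_eq_Suc')
qed simp

lemma even_conj_even: "y \<in># even_conj xs \<Longrightarrow> even y \<and> y > 0"
  by (induction xs arbitrary: y) (auto split: if_splits)

lemma even_conj_eq_empty_iff:
  "sorted_wrt (\<ge>) xs \<Longrightarrow> 0 \<notin> set xs \<Longrightarrow> even_conj xs = {#} \<longleftrightarrow> xs = []"
  using size_even_conj[of xs] by (cases xs) (auto simp flip: size_eq_0_iff_empty)

lemma largest_part_even_conj:
  "sorted_wrt (\<ge>) xs \<Longrightarrow> 0 \<notin> set xs \<Longrightarrow> largest_part (even_conj xs) = 2 * length xs"
  by (induction xs) (auto simp: even_conj_eq_empty_iff simp del: add_2_eq_Suc')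

text \<open>The head is the number of parts, and the parts above 2, lowered by 2, are the image of
  the tail.\<close>

lemma even_conj_inj:
  assumes "sorted_wrt (\<ge>) xs" "0 \<notin> set xs" "sorted_wrt (\<ge>) ys" "0 \<notin> set ys"
    and "even_conj xs = even_conj ys"
  shows "xs = ys"
  using assms
proof (induction xs arbitrary: ys)
  case Nil
  then show ?case using even_conj_eq_empty_iff[of ys] by auto
next
  case (Cons x xs)
  have "ys \<noteq> []"
    using Cons.prems even_conj_eq_empty_iff[of "x # xs"] by auto
  then obtain y ys' where ys: "ys = y # ys'"
    by (cases ys) auto
  have filt: "filter_mset (\<lambda>y. y > 2) (even_conj (z # zs)) = image_mset (\<lambda>y. y + 2) (even_conj zs)"
    for z zs
    unfolding filter_mset_eq_conv by (auto dest: even_conj_even)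
  have "even_conj xs = even_conj ys'"
    using arg_cong[OF Cons.prems(5), of "filter_mset (\<lambda>y. y > 2)"]
    unfolding ys filt by (rule image_mset_add_inj)
  moreover have "x = y"
    using size_even_conj[OF Cons.prems(1)] size_even_conj[OF Cons.prems(3)] Cons.prems(5) ys
    by (simp del: even_conj.simps)
  ultimately show ?case
    using Cons.IH[of ys'] Cons.prems ys by simp
qed

lemma even_conj_surj:
  assumes "\<And>y. y \<in># M \<Longrightarrow> even y \<and> y > 0"
  shows "\<exists>xs. sorted_wrt (\<ge>) xs \<and> 0 \<notin> set xs \<and> even_conj xs = M"
  using assms
proof (induction "largest_part M" arbitrary: M rule: less_induct)
  case less
  show ?case
  proof (cases "M = {#}")
    case True
    then show ?thesis by (intro exI[of _ "[]"]) simp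
  next
    case False
    \<comment> \<open>Undoes the two longest rows: columns of height 2 vanish and all others lose 2,
      so the largest part drops.\<close>
    define M' where "M' = image_mset (\<lambda>y. y - 2) (filter_mset (\<lambda>y. y > 2) M)"
    have M'_even: "even y \<and> y > 0" if "y \<in># M'" for y
      using that less.prems by (auto simp: M'_def)
    have M'_shift: "image_mset (\<lambda>y. y + 2) M' = filter_mset (\<lambda>y. y > 2) M"
      by (auto simp: M'_def multiset.map_comp intro!: image_mset_cong[of _ _ id, simplified])
    have "largest_part M > 0"
      using False largest_part_in less.prems by blast
    moreover have "largest_part M' + 2 \<le> largest_part M" if "M' \<noteq> {#}"
      using that largest_part_mono[of "filter_mset (\<lambda>y. y > 2) M" M]
        largest_part_image_add[of 2 M'] M'_shift by simp
    ultimately have "largest_part M' < largest_part M"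
      by (cases "M' = {#}") auto
    then obtain xs where xs: "sorted_wrt (\<ge>) xs" "0 \<notin> set xs" "even_conj xs = M'"
      using less.hyps M'_even by blast
    have twos: "filter_mset (\<lambda>y. \<not> y > 2) M = replicate_mset (count M 2) 2"
    proof -
      have "filter_mset (\<lambda>y. \<not> y > 2) M = filter_mset (\<lambda>y. y = 2) M"
        using less.prems by (intro filter_mset_cong refl) (force elim!: evenE)
      then show ?thesis by (simp add: filter_eq_replicate_mset)
    qed
    have split: "M = image_mset (\<lambda>y. y + 2) M' + replicate_mset (count M 2) 2"
      using multiset_partition[of M "\<lambda>y. y > 2"] M'_shift twos by simp
    have size: "size M = size M' + count M 2"
      using arg_cong[OF split, of size] by simp
    \<comment> \<open>The longest row meets every column, hence the head
      \<open>size M\<close>.\<close>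
    have "even_conj (size M # xs) = M"
      using xs split size by simp
    moreover have "sorted_wrt (\<ge>) (size M # xs)"
      using xs size size_even_conj[of xs] by (cases xs) auto
    moreover have "0 \<notin> set (size M # xs)"
      using xs False by simp
    ultimately show ?thesis by blast
  qed
qed

section \<open>Sylvester's fish-hook map\<close>

text \<open>The fish-hooks of the centred 2-modular diagram of a partition into odd parts have lengths
  \<open>u > v > \<dots>\<close>: \<open>u\<close> counts the central column and one arm of the largest part, \<open>v\<close> the
  other arm and the column next to the centre on that side. Removing both hooks deletes the
  largest part and all parts 1, and diminishes the others by 2.\<close>

fun sylvester :: "nat list \<Rightarrow> nat multiset" where
  "sylvester [] = {#}"
| "sylvester [u] = replicate_mset u 1"
| "sylvester (u # v # us) =
    add_mset (2 * (v - size (sylvester us)) + 1)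
      (image_mset (\<lambda>y. y + 2) (sylvester us) + replicate_mset (u - v - 1) 1)"

lemma size_sylvester_le:
  "sorted_wrt (>) us \<Longrightarrow> size (sylvester us) \<le> (if us = [] then 0 else hd us)"
  by (induction us rule: sylvester.induct) (auto simp: neq_Nil_conv split: if_splits)

text \<open>Makes the subtraction in the third equation of \<open>sylvester\<close> exact, and the
  new part at least 3, so that it differs from the parts 1.\<close>

lemma size_sylvester_less:
  "sorted_wrt (>) (v # us) \<Longrightarrow> 0 < v \<Longrightarrow> size (sylvester us) < v"
  using size_sylvester_le[of us] by (cases us) auto

lemma size_sylvester:
  "sorted_wrt (>) us \<Longrightarrow> int (size (sylvester us)) = alt_sum us"
  by (induction us rule: sylvester.induct) auto

text \<open>With s parts in \<open>sylvester us\<close>, the hooks \<open>u\<close> and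
  \<open>v\<close> add (2(v - s) + 1) + 2s + (u - v - 1) = u + v.\<close>

lemma sum_mset_sylvester:
  "sorted_wrt (>) us \<Longrightarrow> 0 \<notin> set us \<Longrightarrow> sum_mset (sylvester us) = sum_list us"
proof (induction us rule: sylvester.induct)
  case (3 u v us)
  then have "size (sylvester us) < v"
    by (intro size_sylvester_less) auto
  with 3 show ?case by (simp add: sum_mset_image_add del: add_2_eq_Suc')
qed auto

lemma sylvester_odd: "y \<in># sylvester us \<Longrightarrow> odd y"
  by (induction us arbitrary: y rule: sylvester.induct) (auto split: if_splits)

lemma sylvester_eq_empty_iff: "0 \<notin> set us \<Longrightarrow> sylvester us = {#} \<longleftrightarrow> us = []"
  by (cases us rule: sylvester.cases) (auto simp flip: size_eq_0_iff_empty)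

text \<open>A pair of hooks adds u - v parts, so \<open>hd us\<close> minus the size is v - s, with
  s the size before. The added part is maximal because the next hook is shorter than
  \<open>v\<close>; a single hook gives only parts 1, matching 2 * 0 + 1.\<close>

lemma largest_part_sylvester:
  "sorted_wrt (>) us \<Longrightarrow> 0 \<notin> set us \<Longrightarrow>
    largest_part (sylvester us) = (if us = [] then 0 else 2 * (hd us - size (sylvester us)) + 1)"
proof (induction us rule: sylvester.induct)
  case (3 u v us)
  then have "size (sylvester us) < v"
    by (intro size_sylvester_less) auto
  with 3 show ?case by (cases us) (auto simp: sylvester_eq_empty_iff simp del: add_2_eq_Suc')
qed auto

lemma filter_sylvester:
  "filter_mset (\<lambda>y. y > 1) (image_mset (\<lambda>y. y + 2) M + replicate_mset k 1) =
    image_mset (\<lambda>y. y + 2) M" for M :: "nat multiset"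
  unfolding filter_mset_eq_conv by auto

text \<open>The largest part determines v - s. Once it is removed, the parts above 1 determine the
  remaining hooks, hence s and \<open>v\<close>, and the number of parts 1 then determines
  \<open>u\<close>.\<close>

lemma sylvester_inj:
  assumes "sorted_wrt (>) us" "0 \<notin> set us" "sorted_wrt (>) vs" "0 \<notin> set vs"
    and "sylvester us = sylvester vs"
  shows "us = vs"
  using assms
proof (induction us arbitrary: vs rule: sylvester.induct)
  case 1
  then show ?case using sylvester_eq_empty_iff[of vs] by auto
next
  case (2 u)
  have "vs \<noteq> []" using 2 sylvester_eq_empty_iff[of "[u]"] by auto
  \<comment> \<open>Two or more hooks produce a part of at least 3, one hook only parts 1.\<close>
  moreover have False if vs: "vs = v # w # ws" for v w ws
  proof -
    have "size (sylvester ws) < w"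
      using 2 vs by (intro size_sylvester_less) auto
    moreover have "2 * (w - size (sylvester ws)) + 1 \<in># replicate_mset u 1"
      using 2 vs by simp
    ultimately show False by (simp split: if_splits)
  qed
  ultimately obtain v where "vs = [v]" by (cases vs rule: sylvester.cases) auto
  with arg_cong[OF 2(5), of size] show ?case by simp
next
  case (3 u v us)
  have less: "size (sylvester us) < v"
    using "3.prems"(1,2) by (intro size_sylvester_less) auto
  have "vs \<noteq> []" using "3.prems"(5) by auto
  moreover have False if vs: "vs = [w]" for w
  proof -
    have "2 * (v - size (sylvester us)) + 1 \<in># replicate_mset w 1"
      using "3.prems"(5) vs by (metis sylvester.simps(2,3) union_single_eq_member)
    then show False using less by (simp split: if_splits)
  qed
  ultimately obtain u' v' us' where vs: "vs = u' # v' # us'"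
    by (cases vs rule: sylvester.cases) auto
  have less': "size (sylvester us') < v'"
    using "3.prems"(3,4) vs by (intro size_sylvester_less) auto
  \<comment> \<open>Rewrites the formula of \<open>largest_part_sylvester\<close> into the form
    occurring in the recursion.\<close>
  have size: "u - size (sylvester (u # v # us)) = v - size (sylvester us)"
    if "sorted_wrt (>) (u # v # us)" "size (sylvester us) < v" for u v us
    using that by simp
  have top: "v - size (sylvester us) = v' - size (sylvester us')"
    using "3.prems" vs largest_part_sylvester[of "u # v # us"] largest_part_sylvester[of vs]
      size[of u v us] size[of u' v' us'] less less' by simp
  then have rest: "image_mset (\<lambda>y. y + 2) (sylvester us) + replicate_mset (u - v - 1) 1 =
      image_mset (\<lambda>y. y + 2) (sylvester us') + replicate_mset (u' - v' - 1) 1"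
    using "3.prems"(5) vs by simp
  then have "sylvester us = sylvester us'"
    using arg_cong[OF rest, of "filter_mset (\<lambda>y. y > 1)"]
    unfolding filter_sylvester by (blast dest: image_mset_add_inj)
  moreover from this have "us = us'" using "3.IH"(1)[of us'] "3.prems"(1-4) vs by simp
  moreover have "u - v - 1 = u' - v' - 1"
    using arg_cong[OF rest, of size] calculation by simp
  ultimately show ?case
    using top less less' "3.prems"(1,3) vs by auto
qed

lemma sylvester_surj:
  assumes "\<And>y. y \<in># M \<Longrightarrow> odd y"
  shows "\<exists>us. sorted_wrt (>) us \<and> 0 \<notin> set us \<and> sylvester us = M"
  using assms
proof (induction "size M" arbitrary: M rule: less_induct)
  case less
  consider "M = {#}" | "M \<noteq> {#}" "\<forall>y\<in>#M. y = 1" | z where "z \<in># M" "z \<noteq> 1"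
    by blast
  then show ?case
  proof cases
    case 1
    then show ?thesis by (intro exI[of _ "[]"]) simp
  next
    case 2
    then have "M = replicate_mset (size M) 1"
      by (metis size_replicate_mset set_mset_subset_singletonD singletonI subsetI)
    with 2 show ?thesis by (intro exI[of _ "[size M]"]) auto
  next
    case 3
    then have "M \<noteq> {#}" by auto
    define m where "m = largest_part M"
    have m: "m \<in># M" "z \<le> m" "odd m"
      using 3 \<open>M \<noteq> {#}\<close> le_largest_part[of z M] largest_part_in[of M] less.prems[of "largest_part M"]
      by (auto simp: m_def)
    moreover have "odd z" using 3 less.prems by blast
    ultimately have "m \<ge> 3" using 3 by (auto elim!: oddE)
    with \<open>odd m\<close> obtain k where k: "m = 2 * k + 1" "k > 0" by (auto elim!: oddE)
    define N where "N = M - {#m#}"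
    have MN: "M = add_mset m N" using m by (simp add: N_def)
    define M' where "M' = image_mset (\<lambda>y. y - 2) (filter_mset (\<lambda>y. y > 1) N)"
    have N_odd: "odd y" if "y \<in># N" for y
      using that less.prems MN by simp
    \<comment> \<open>Hence the subtraction of 2 in \<open>M'\<close> is exact and leaves odd
      numbers.\<close>
    have N_ge: "y \<ge> 3" if "y \<in># N" "y > 1" for y
      using N_odd[OF that(1)] that(2) by (auto elim!: oddE)
    have M'_odd: "odd y" if "y \<in># M'" for y
      using that N_odd N_ge by (fastforce simp: M'_def)
    have M'_shift: "image_mset (\<lambda>y. y + 2) M' = filter_mset (\<lambda>y. y > 1) N"
      using N_ge
      by (auto simp: M'_def multiset.map_comp intro!: image_mset_cong[of _ _ id, simplified])
    have "size M' < size M"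
      by (simp add: M'_def MN less_Suc_eq_le size_filter_mset_lesseq)
    then obtain us where us: "sorted_wrt (>) us" "0 \<notin> set us" "sylvester us = M'"
      using less.hyps M'_odd by blast
    have "filter_mset (\<lambda>y. \<not> y > 1) N = filter_mset (\<lambda>y. y = 1) N"
      using N_odd by (intro filter_mset_cong refl) (force elim!: oddE)
    then have split: "N = image_mset (\<lambda>y. y + 2) M' + replicate_mset (count N 1) 1"
      using multiset_partition[of N "\<lambda>y. y > 1"] M'_shift by (simp add: filter_eq_replicate_mset)
    \<comment> \<open>Solves v - s = k and u - v - 1 = \<open>count N 1\<close>, where s =
      \<open>size M'\<close>.\<close>
    define v where "v = k + size M'"
    define u where "u = v + 1 + count N 1"
    \<comment> \<open>As m = 2k + 1 is maximal in \<open>M\<close>, 2(hd us - s) + 3 \<le> 2k + 1,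
      which is the required decrease from \<open>v\<close> to the next hook.\<close>
    have hd: "hd us < v" if "us \<noteq> []"
    proof -
      have "M' \<noteq> {#}"
        using that us sylvester_eq_empty_iff by blast
      then have "largest_part M' + 2 = largest_part (filter_mset (\<lambda>y. y > 1) N)"
        using largest_part_image_add[of 2 M'] unfolding M'_shift by simp
      also have "\<dots> \<le> m"
        unfolding m_def N_def
        by (intro largest_part_mono)
          (meson diff_subset_eq_self multiset_filter_subset subset_mset.order_trans)
      finally have "largest_part M' + 2 \<le> m" .
      then show ?thesis
        using largest_part_sylvester[of us] us that k by (simp add: v_def)
    qed
    have "sylvester (u # v # us) = M"
      using us split MN k by (simp add: u_def v_def)
    moreover have "sorted_wrt (>) (u # v # us)"
      using us hd by (cases us) (auto simp: u_def)
    moreover have "0 \<notin> set (u # v # us)"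
      using us k by (auto simp: u_def v_def)
    ultimately show ?thesis by blast
  qed
qed

section \<open>Two bijections from a common set of pairs\<close>

definition merge :: "nat list \<times> nat list \<Rightarrow> nat multiset" where
  "merge = (\<lambda>(xs, us). mset xs + mset xs + mset us)"

text \<open>Ordering the lists gives each multiset of paired values and each set of unpaired parts a
  unique code, in the order in which the recursions peel off parts.\<close>

definition split_shapes :: "(nat list \<times> nat list) set" where
  "split_shapes = {(xs, us). sorted_wrt (\<ge>) xs \<and> 0 \<notin> set xs \<and> sorted_wrt (>) us \<and> 0 \<notin> set us}"

definition regroup :: "nat list \<times> nat list \<Rightarrow> nat multiset" where
  "regroup = (\<lambda>(xs, us). even_conj xs + sylvester us)"

lemma sorted_wrt_greater_distinct: "sorted_wrt (>) us \<Longrightarrow> distinct us" for us :: "nat list"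
  by (induction us) auto

lemma sorted_wrt_ge_unique:
  fixes xs ys :: "nat list"
  assumes "sorted_wrt (\<ge>) xs" "sorted_wrt (\<ge>) ys" "mset xs = mset ys"
  shows "xs = ys"
proof -
  have "sorted (rev xs)" "sorted (rev ys)"
    using assms by (simp_all add: sorted_wrt_rev)
  then have "rev xs = rev ys"
    using assms(3) by (metis mset_rev properties_for_sort)
  then show ?thesis by simp
qed

lemma unpaired_parts_merge:
  assumes "(xs, us) \<in> split_shapes"
  shows "unpaired_parts (merge (xs, us)) = set us"
proof -
  have "distinct us" using assms by (simp add: split_shapes_def sorted_wrt_greater_distinct)
  then show ?thesis
    by (auto simp: unpaired_parts_def merge_def distinct_count_atmost_1)
qed

lemma rev_sorted_list_of_set_eq:
  fixes us :: "nat list"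
  assumes "sorted_wrt (>) us"
  shows "rev (sorted_list_of_set (set us)) = us"
proof -
  have "sorted (rev us)" "distinct us"
    using assms strict_sorted_iff[of "rev us"] by (simp_all add: sorted_wrt_rev)
  then have "sorted_list_of_set (set us) = rev us"
    by (intro sorted_distinct_set_unique) auto
  then show ?thesis by simp
qed

lemma paired_parts_merge:
  assumes "(xs, us) \<in> split_shapes"
  shows "paired_parts (merge (xs, us)) = mset xs + mset xs"
proof -
  have "distinct us" using assms by (simp add: split_shapes_def sorted_wrt_greater_distinct)
  then have "mset_set (set us) = mset us" by (simp add: mset_set_set)
  then show ?thesis
    using unpaired_parts_merge[OF assms] by (simp add: paired_parts_def merge_def)
qed

text \<open>The unpaired parts recover \<open>us\<close>; halving the multiplicities of the paired
  parts recovers \<open>xs\<close>.\<close>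

lemma inj_on_merge: "inj_on merge split_shapes"
proof (rule inj_onI, clarify)
  fix xs us ys vs
  assume xs: "(xs, us) \<in> split_shapes" and ys: "(ys, vs) \<in> split_shapes"
    and eq: "merge (xs, us) = merge (ys, vs)"
  have "set us = set vs" using unpaired_parts_merge xs ys eq by metis
  then have "us = vs"
    using rev_sorted_list_of_set_eq xs ys
    by (metis (no_types, lifting) case_prodD mem_Collect_eq split_shapes_def)
  moreover have "mset xs + mset xs = mset ys + mset ys"
    using paired_parts_merge xs ys eq by metis
  then have "2 * count (mset xs) k = 2 * count (mset ys) k" for k
    by (metis count_union mult_2)
  then have "mset xs = mset ys" by (intro multiset_eqI) simp
  then have "xs = ys" using xs ys by (auto simp: split_shapes_def intro: sorted_wrt_ge_unique)
  ultimately show "xs = ys \<and> us = vs" by simp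
qed

lemma merge_surj:
  assumes "0 \<notin># L"
  shows "L \<in> merge ` split_shapes"
proof -
  \<comment> \<open>One representative of each pair; the remainders modulo 2 go into
    \<open>us\<close>.\<close>
  define M where "M = (\<Sum>k\<in>set_mset L. replicate_mset (count L k div 2) k)"
  have count_M: "count M k = count L k div 2" for k
    by (simp add: M_def count_sum not_in_iff)
  define xs where "xs = rev (sorted_list_of_multiset M)"
  define us where "us = rev (sorted_list_of_set (unpaired_parts L))"
  have fin: "finite (unpaired_parts L)" by (simp add: unpaired_parts_def)
  have "0 \<notin># M"
    using assms count_M[of 0] by (simp add: not_in_iff)
  then have "(xs, us) \<in> split_shapes"
    using assms fin
    by (auto simp: split_shapes_def xs_def us_def sorted_wrt_rev unpaired_parts_def)
  moreover have "merge (xs, us) = L"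
  proof (rule multiset_eqI)
    fix k
    have "mset us = mset_set (unpaired_parts L)"
      using fin by (simp add: us_def flip: mset_set_set)
    then have "count (mset us) k = count L k mod 2"
      using fin by (auto simp: count_mset_set' unpaired_parts_def not_in_iff odd_iff_mod_2_eq_one)
    moreover have "count L k div 2 + count L k div 2 + count L k mod 2 = count L k"
      by presburger
    ultimately show "count (merge (xs, us)) k = count L k"
      by (simp add: merge_def xs_def count_M)
  qed
  ultimately show ?thesis by (metis image_eqI)
qed

text \<open>Parity separates the two summands, and each component map is injective.\<close>

lemma inj_on_regroup: "inj_on regroup split_shapes"
proof (rule inj_onI, clarify)
  fix xs us ys vs
  assume xs: "(xs, us) \<in> split_shapes" and ys: "(ys, vs) \<in> split_shapes"
    and eq: "regroup (xs, us) = regroup (ys, vs)"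
  have "filter_mset even (regroup (xs, us)) = even_conj xs"
    and "filter_mset odd (regroup (xs, us)) = sylvester us" for xs us
    unfolding filter_mset_eq_conv by (auto simp: regroup_def dest: even_conj_even sylvester_odd)
  then have "even_conj xs = even_conj ys" "sylvester us = sylvester vs"
    using eq by metis+
  then show "xs = ys \<and> us = vs"
    using xs ys by (auto simp: split_shapes_def intro: even_conj_inj sylvester_inj)
qed

lemma regroup_surj:
  assumes "0 \<notin># L"
  shows "L \<in> regroup ` split_shapes"
proof -
  obtain xs where "sorted_wrt (\<ge>) xs" "0 \<notin> set xs" "even_conj xs = filter_mset even L"
    using even_conj_surj[of "filter_mset even L"] assms by (auto intro: gr0I)
  moreover obtain us where "sorted_wrt (>) us" "0 \<notin> set us" "sylvester us = filter_mset odd L"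
    using sylvester_surj[of "filter_mset odd L"] by auto
  ultimately have "(xs, us) \<in> split_shapes" "regroup (xs, us) = L"
    using multiset_partition[of L even] by (auto simp: split_shapes_def regroup_def)
  then show ?thesis by (metis image_eqI)
qed

lemma merge_regroup_stats:
  assumes "p \<in> split_shapes"
  shows "merge p \<in> partitions_of n \<longleftrightarrow> regroup p \<in> partitions_of n"
    and "pairing_index (merge p) = int (size (regroup p))"
    and "pairing_width (merge p) = int (largest_part (regroup p))"
proof -
  obtain xs us where p: "p = (xs, us)" by fastforce
  have xs: "sorted_wrt (\<ge>) xs" "0 \<notin> set xs" and us: "sorted_wrt (>) us" "0 \<notin> set us"
    using assms p by (auto simp: split_shapes_def)
  have "0 \<notin># merge p" "0 \<notin># regroup p"
    using xs us by (auto simp: p merge_def regroup_def dest: even_conj_even sylvester_odd)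
  moreover have "sum_mset (merge p) = sum_mset (regroup p)"
    using xs us by (simp add: p merge_def regroup_def sum_mset_even_conj sum_mset_sylvester
        sum_mset_sum_list)
  ultimately show "merge p \<in> partitions_of n \<longleftrightarrow> regroup p \<in> partitions_of n"
    by (simp add: partitions_of_def)
  have unpaired: "unpaired_alt_sum (merge p) = int (size (sylvester us))"
    using assms us by (simp add: p unpaired_alt_sum_def unpaired_parts_merge
        rev_sorted_list_of_set_eq size_sylvester)
  \<comment> \<open>Both this and the number of columns equal the longest row \<open>hd xs\<close>,
    or 0 for the empty list.\<close>
  have "pair_rank (merge p) = largest_part (mset xs)"
    using assms by (simp add: p pair_rank_def paired_parts_merge largest_part_def)
  also have "\<dots> = size (even_conj xs)"
    using xs by (cases xs) (auto simp: size_even_conj largest_part_def intro!: Max_eqI)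
  finally show "pairing_index (merge p) = int (size (regroup p))"
    using unpaired by (simp add: pairing_index_def p regroup_def)
  have "residual_span (merge p) = int (largest_part (sylvester us))"
  proof (cases us)
    case (Cons u ws)
    have "Max (set us) = u"
      using us Cons by (intro Max_eqI) auto
    \<comment> \<open>Reconciles the integer subtraction in \<open>residual_span\<close> with the
      natural one in \<open>largest_part_sylvester\<close>.\<close>
    moreover have "size (sylvester us) \<le> u"
      using size_sylvester_le[of us] us Cons by simp
    ultimately show ?thesis
      using assms unpaired us Cons largest_part_sylvester[of us]
      by (simp add: residual_span_def p unpaired_parts_merge of_nat_diff)
  qed (use assms in \<open>simp add: residual_span_def p unpaired_parts_merge\<close>)
  \<comment> \<open>The pair span is \<open>2 * length xs\<close>, the largest even part, and the
    largest part of a union is a maximum.\<close>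
  then show "pairing_width (merge p) = int (largest_part (regroup p))"
    using assms xs by (simp add: pairing_width_def pair_span_def p paired_parts_merge regroup_def
        largest_part_even_conj)
qed

theorem theorem2p6:
  fixes n a b :: nat
  shows "card {L \<in> partitions_of n. pairing_index L = int a \<and> pairing_width L = int b}
       = card {L \<in> partitions_of n. size L = a \<and> largest_part L = b}"
proof -
  define S where "S = {p \<in> split_shapes. regroup p \<in> partitions_of n \<and>
    size (regroup p) = a \<and> largest_part (regroup p) = b}"
  \<comment> \<open>The same index set described through \<open>merge\<close>, so both counted sets
    are injective images of \<open>S\<close>.\<close>
  have "S = {p \<in> split_shapes. merge p \<in> partitions_of n \<and>
      pairing_index (merge p) = int a \<and> pairing_width (merge p) = int b}"
    by (auto simp: S_def merge_regroup_stats)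
  moreover have "partitions_of n \<subseteq> merge ` split_shapes" "partitions_of n \<subseteq> regroup ` split_shapes"
    by (auto simp: partitions_of_def intro: merge_surj regroup_surj)
  ultimately have
    "{L \<in> partitions_of n. pairing_index L = int a \<and> pairing_width L = int b} = merge ` S"
    "{L \<in> partitions_of n. size L = a \<and> largest_part L = b} = regroup ` S"
    unfolding S_def by blast+
  moreover have "inj_on merge S" "inj_on regroup S"
    using inj_on_merge inj_on_regroup by (auto simp: S_def intro: inj_on_subset)
  ultimately show ?thesis by (simp add: card_image)
qed

end
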